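(* Let $A\in\mathbb{R}^{m\times n}$, $A\neq 0$, and $B\in\mathbb{R}^{m\times p}$ be such that the matrix equation $AX=B$ is consistent (i.e. it has a solution $X\in\mathbb{R}^{n\times p}$). Let $X^{(0)}\in\mathbb{R}^{n\times p}$ be arbitrary and let $\{X^{(k)}\}_{k\ge 0}$ be generated by the randomized Kaczmarz iteration $$X^{(k+1)}=X^{(k)}+\frac{(A_{i,:})^T}{\|A_{i,:}\|_2^2}\bigl(B_{i,:}-A_{i,:}X^{(k)}\bigr),\qquad k\ge 0,$$ where at each iteration the row index $i\in\{1,\dots,m\}$ is selected at random with probability $\|A_{i,:}\|_2^2/\|A\|_F^2$. Then $\{X^{(k)}\}$ converges linearly in mean square to $X^*=A^+B+(I_n-A^+A)X^{(0)}$, and for all $k\ge 0$ $$E\bigl[\|X^{(k)}-X^*\|_F^2\bigr]\le\left(1-\frac{\sigma_{\min}^2(A)}{\|A\|_F^2}\right)^k\|X^{(0)}-X^*\|_F^2 .$$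
   Context: $A_{i,:}$ denotes the $i$th row of $A$, $A^+$ the Moore-Penrose inverse, $\|\cdot\|_F$ the Frobenius norm, $\sigma_{\min}(A)$ the smallest nonzero singular value of $A$, and $I_n$ the $n\times n$ identity. The index selections at different iterations are independent; zero rows have probability zero and are never selected. "Converges linearly in mean square to $X^*$" means that $E[\|X^{(k)}-X^*\|_F^2]\to 0$ at a geometric rate (bounded by $c\,q^k$ for some $c\ge 0$ and $q\in[0,1)$). *)

theory Defs
  imports "HOL-Analysis.Analysis" "HOL-Probability.Probability"
begin

definition frob_norm :: "real^'n^'m \<Rightarrow> real" where
  "frob_norm A = sqrt (\<Sum>i\<in>UNIV. \<Sum>j\<in>UNIV. (A $ i $ j)\<^sup>2)"

lemma frob_norm_eq_norm: "frob_norm A = norm A"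
  by (simp add: frob_norm_def norm_vec_def L2_set_def sum_nonneg)

definition penrose_conditions :: "real^'n^'m \<Rightarrow> real^'m^'n \<Rightarrow> bool" where
  "penrose_conditions A P \<longleftrightarrow>
     A ** P ** A = A \<and>
     P ** A ** P = P \<and>
     transpose (A ** P) = A ** P \<and>
     transpose (P ** A) = P ** A"

text \<open>Every real matrix has exactly one Moore-Penrose inverse, so the description below is proper.\<close>

definition pinv :: "real^'n^'m \<Rightarrow> real^'m^'n" where
  "pinv A = (THE P. penrose_conditions A P)"

text \<open>
  Singular values are the nonnegative square roots of the eigenvalues of \<open>A\<^sup>T A\<close>. Whether one lists
  \<open>n\<close> or \<open>min m n\<close> of them only affects the value zero, which \<open>sigma_min\<close> ignores. For
  \<open>A \<noteq> 0\<close> the set of nonzero singular values is finite and nonempty, so \<open>Min\<close> is its least element.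
\<close>

definition singular_value :: "real^'n^'m \<Rightarrow> real \<Rightarrow> bool" where
  "singular_value A s \<longleftrightarrow>
     0 \<le> s \<and> (\<exists>v. v \<noteq> 0 \<and> (transpose A ** A) *v v = s\<^sup>2 *\<^sub>R v)"

definition sigma_min :: "real^'n^'m \<Rightarrow> real" where
  "sigma_min A = Min {s. singular_value A s \<and> s \<noteq> 0}"

text \<open>
  Entry \<open>(j, l)\<close> of \<open>X + (A\<^sub>i)\<^sup>T / \<parallel>A\<^sub>i\<parallel>\<^sup>2 (B\<^sub>i - A\<^sub>i X)\<close>. For a zero row, division by zero makes
  this the identity step; such rows are selected with probability zero.
\<close>

definition kaczmarz_step ::
    "real^'n^'m \<Rightarrow> real^'p^'m \<Rightarrow> 'm \<Rightarrow> real^'p^'n \<Rightarrow> real^'p^'n" where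
  "kaczmarz_step A B i X =
     X + (\<chi> j l. row i A $ j / (norm (row i A))\<^sup>2 * (row i B - row i A v* X) $ l)"

primrec kaczmarz ::
    "real^'n^'m \<Rightarrow> real^'p^'m \<Rightarrow> real^'p^'n \<Rightarrow> (nat \<Rightarrow> 'm) \<Rightarrow> nat \<Rightarrow> real^'p^'n" where
  "kaczmarz A B X0 idx 0 = X0"
| "kaczmarz A B X0 idx (Suc k) = kaczmarz_step A B (idx k) (kaczmarz A B X0 idx k)"

text \<open>
  Independent row selections on a probability space \<open>M\<close>: \<open>idx k\<close> is the row used to pass from
  iterate \<open>k\<close> to iterate \<open>k + 1\<close>. Measurability of each \<open>idx k\<close> is part of \<open>indep_vars\<close>.
\<close>

definition row_selection :: "'w measure \<Rightarrow> real^'n^'m \<Rightarrow> (nat \<Rightarrow> 'w \<Rightarrow> 'm) \<Rightarrow> bool" where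
  "row_selection M A idx \<longleftrightarrow>
     prob_space.indep_vars M (\<lambda>_. count_space UNIV) idx UNIV \<and>
     (\<forall>k i. measure M {\<omega> \<in> space M. idx k \<omega> = i} = (norm (row i A))\<^sup>2 / (frob_norm A)\<^sup>2)"

text \<open>
  Integrability is demanded explicitly because the Bochner integral of a non-integrable function
  is zero by convention.
\<close>

definition converges_linearly_in_mean_square ::
    "'w measure \<Rightarrow> (nat \<Rightarrow> 'w \<Rightarrow> real^'p^'n) \<Rightarrow> real^'p^'n \<Rightarrow> bool" where
  "converges_linearly_in_mean_square M X Y \<longleftrightarrow>
     (\<forall>k. integrable M (\<lambda>\<omega>. (frob_norm (X k \<omega> - Y))\<^sup>2)) \<and>
     (\<exists>c q. 0 \<le> c \<and> 0 \<le> q \<and> q < 1 \<and>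
        (\<forall>k. (\<integral>\<omega>. (frob_norm (X k \<omega> - Y))\<^sup>2 \<partial>M) \<le> c * q ^ k))"

end

theory Submission
  imports Defs
begin

text \<open>
  Since \<open>A X* = B\<close>, a Kaczmarz step replaces every column \<open>e\<close> of the error \<open>X - X*\<close> by its
  projection onto the orthogonal complement of the selected row \<open>a\<close>, which lowers \<open>\<parallel>e\<parallel>\<^sup>2\<close> by
  \<open>(a \<bullet> e)\<^sup>2 / \<parallel>a\<parallel>\<^sup>2\<close>. Averaged over the row probabilities this is a decrease by
  \<open>\<parallel>A e\<parallel>\<^sup>2 / \<parallel>A\<parallel>\<^sup>2\<close>. The initial error is \<open>A\<^sup>+ A (X0 - Z)\<close> for any solution \<open>Z\<close>, so its columns lie
  in the row space of \<open>A\<close>; they stay there, and on the row space \<open>\<parallel>A e\<parallel> \<ge> \<sigma>\<^sub>m\<^sub>i\<^sub>n \<parallel>e\<parallel>\<close>. As the \<open>k\<close>-th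
  row index is independent of the \<open>k\<close>-th iterate, the pointwise mean estimate passes to expectations.
\<close>

section \<open>The Moore-Penrose inverse\<close>

lemma matrix_mult_diff_ldistrib:
  fixes A :: "real^'n^'m" and X Y :: "real^'p^'n"
  shows "A ** (X - Y) = A ** X - A ** Y"
  by (simp add: matrix_matrix_mult_def vec_eq_iff algebra_simps sum_subtractf)

lemma matrix_mult_diff_rdistrib:
  fixes A B :: "real^'n^'m" and X :: "real^'p^'n"
  shows "(A - B) ** X = A ** X - B ** X"
  by (simp add: matrix_matrix_mult_def vec_eq_iff algebra_simps sum_subtractf)

lemma column_matrix_mult:
  fixes A :: "real^'n^'m" and X :: "real^'p^'n"
  shows "column l (A ** X) = A *v column l X"
  by (simp add: vec_eq_iff column_def matrix_matrix_mult_def matrix_vector_mult_def)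

text \<open>Least squares: split \<open>y\<close> into its projection \<open>u\<close> on the column
  space and a remainder \<open>z\<close> orthogonal to it. \<open>transpose A\<close> annihilates
  \<open>z\<close>, and \<open>u\<close> has the form \<open>A *v x\<close>.\<close>

lemma normal_equations_solvable:
  fixes A :: "real^'n^'m"
  shows "\<exists>x. transpose A *v (A *v x) = transpose A *v y"
proof -
  have span: "span (range ((*v) A)) = range ((*v) A)"
    by (simp add: span_eq_iff linear_subspace_image)
  obtain u z where u: "u \<in> span (range ((*v) A))"
    and z: "\<And>w. w \<in> span (range ((*v) A)) \<Longrightarrow> orthogonal z w" and y: "y = u + z"
    using orthogonal_subspace_decomp_exists by blast
  obtain x where x: "u = A *v x" using u span by auto
  have "(z v* A) \<bullet> w = 0" for w
    using z[of "A *v w"] span by (simp add: dot_lmul_matrix orthogonal_def)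
  then have "z v* A = 0" by (metis inner_eq_zero_iff)
  then have "transpose A *v u = transpose A *v y"
    unfolding y matrix_vector_right_distrib by simp
  then show ?thesis using x by blast
qed

lemma normal_equations_matrix:
  fixes A :: "real^'n^'m"
  obtains W :: "real^'m^'n" where "transpose A ** (A ** W) = transpose A"
proof -
  have "\<forall>j. \<exists>x. transpose A *v (A *v x) = transpose A *v axis j 1"
    using normal_equations_solvable by blast
  from choice[OF this]
  obtain x where x: "transpose A *v (A *v x j) = transpose A *v axis j 1" for j
    by blast
  define W :: "real^'m^'n" where "W = (\<chi> i j. x j $ i)"
  have colW: "column j W = x j" for j
    by (simp add: W_def column_def vec_eq_iff)
  have "column j (transpose A ** (A ** W)) = column j (transpose A)" for j
    unfolding column_matrix_mult colW x by (rule matrix_vector_mult_basis)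
  then have "transpose A ** (A ** W) = transpose A"
    by (simp add: vec_eq_iff column_def)
  then show ?thesis by (rule that)
qed

text \<open>The normal equations give
  \<open>transpose (A ** W) ** (A ** W) = transpose (A ** W)\<close>. The left side is symmetric,
  hence so is \<open>A ** W\<close>, and it is the orthogonal projection onto the column
  space.\<close>

lemma left_projection_exists:
  fixes A :: "real^'n^'m"
  obtains W :: "real^'m^'n" where "transpose (A ** W) = A ** W" "A ** W ** A = A"
proof -
  obtain W where W: "transpose A ** (A ** W) = transpose A"
    by (rule normal_equations_matrix)
  have idem: "transpose (A ** W) ** (A ** W) = transpose (A ** W)"
    by (metis W matrix_mul_assoc matrix_transpose_mul)
  then have sym: "transpose (A ** W) = A ** W"
    by (metis matrix_transpose_mul transpose_transpose)
  have "transpose (A ** W) ** A = A"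
    by (metis W matrix_transpose_mul transpose_transpose)
  then show ?thesis using that sym by simp
qed

text \<open>With one-sided inverses making \<open>A W\<close> and \<open>U A\<close> orthogonal projections, the Moore-Penrose
  inverse is \<open>U A W\<close>.\<close>

lemma penrose_exists:
  fixes A :: "real^'n^'m"
  shows "\<exists>P. penrose_conditions A P"
proof -
  obtain W where W: "transpose (A ** W) = A ** W" "A ** W ** A = A"
    by (rule left_projection_exists)
  \<comment> \<open>The same fact for \<open>transpose A\<close>; transposing it yields the
    projection \<open>U ** A\<close> onto the row space.\<close>
  obtain V where V: "transpose (transpose A ** V) = transpose A ** V"
    "transpose A ** V ** transpose A = transpose A"
    by (rule left_projection_exists)
  define U where "U = transpose V"
  have U: "transpose (U ** A) = U ** A" "A ** U ** A = A"
    using V unfolding U_def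
    by (metis matrix_transpose_mul transpose_transpose matrix_mul_assoc)+
  let ?P = "U ** A ** W"
  have AP: "A ** ?P = A ** W" using U(2) by (metis matrix_mul_assoc)
  have PA: "?P ** A = U ** A" using W(2) by (metis matrix_mul_assoc)
  have "A ** ?P ** A = A" using AP W by simp
  moreover have "?P ** A ** ?P = ?P"
    unfolding PA using U(2) by (metis matrix_mul_assoc)
  ultimately show ?thesis
    unfolding penrose_conditions_def by (metis AP PA U(1) W(1))
qed

text \<open>Symmetry lets the two projections \<open>A ** P\<close> and \<open>A ** Q\<close> be
  swapped in a product, so they agree; likewise \<open>P ** A\<close> and \<open>Q ** A\<close>.
  Then \<open>P = P A P = Q A P = Q A Q = Q\<close>.\<close>

lemma penrose_unique:
  fixes A :: "real^'n^'m"
  assumes P: "penrose_conditions A P" and Q: "penrose_conditions A Q"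
  shows "P = Q"
proof -
  have p: "A ** P ** A = A" "P ** A ** P = P" "transpose (A ** P) = A ** P"
      "transpose (P ** A) = P ** A"
    and q: "A ** Q ** A = A" "Q ** A ** Q = Q" "transpose (A ** Q) = A ** Q"
      "transpose (Q ** A) = Q ** A"
    using P Q by (auto simp: penrose_conditions_def)
  have "A ** P = (A ** Q) ** (A ** P)" using q(1) by (metis matrix_mul_assoc)
  also have "\<dots> = transpose ((A ** P) ** (A ** Q))"
    using p(3) q(3) by (metis matrix_transpose_mul)
  also have "\<dots> = A ** Q" using p(1) q(3) by (metis matrix_mul_assoc)
  finally have AP: "A ** P = A ** Q" .
  have "P ** A = (P ** A) ** (Q ** A)" using q(1) by (metis matrix_mul_assoc)
  also have "\<dots> = transpose ((Q ** A) ** (P ** A))"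
    using p(4) q(4) by (metis matrix_transpose_mul)
  also have "\<dots> = Q ** A" using p(1) q(4) by (metis matrix_mul_assoc)
  finally have PA: "P ** A = Q ** A" .
  show "P = Q" by (metis AP PA p(2) q(2) matrix_mul_assoc)
qed

lemma penrose_pinv: "penrose_conditions A (pinv A)"
  unfolding pinv_def by (rule theI') (use penrose_exists penrose_unique in blast)

section \<open>The smallest nonzero singular value\<close>

lemma subspace_row_space:
  fixes A :: "real^'n^'m"
  shows "subspace (range (\<lambda>y. y v* A))"
proof -
  have "subspace (range ((*v) (transpose A)))"
    by (intro linear_subspace_image subspace_UNIV matrix_vector_mul_linear)
  then show ?thesis by simp
qed

lemma row_in_row_space:
  fixes A :: "real^'n^'m"
  shows "row i A \<in> range (\<lambda>y. y v* A)"
proof -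
  have "row i A = axis i 1 v* A"
    using matrix_vector_mult_basis[of "transpose A" i] by simp
  then show ?thesis by blast
qed

text \<open>Needed for \<open>Min\<close> in \<open>sigma_min\<close> to be meaningful. Eigenvectors
  of the symmetric matrix \<open>transpose A ** A\<close> for distinct eigenvalues are orthogonal,
  hence independent, and independent sets are finite here.\<close>

lemma finite_singular_values:
  fixes A :: "real^'n^'m"
  shows "finite {s. singular_value A s}"
proof -
  let ?S = "{s. singular_value A s}"
  obtain v where v: "\<And>s. s \<in> ?S \<Longrightarrow> v s \<noteq> 0 \<and> (transpose A ** A) *v v s = s\<^sup>2 *\<^sub>R v s"
    using that[of "\<lambda>s. SOME v. v \<noteq> 0 \<and> (transpose A ** A) *v v = s\<^sup>2 *\<^sub>R v"]
    by (metis (mono_tags, lifting) mem_Collect_eq singular_value_def someI_ex)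
  have sym: "((transpose A ** A) *v x) \<bullet> y = x \<bullet> ((transpose A ** A) *v y)" for x y
    by (metis dot_lmul_matrix matrix_transpose_mul transpose_matrix_vector transpose_transpose)
  have orth: "v s \<bullet> v t = 0" if "s \<in> ?S" "t \<in> ?S" "s \<noteq> t" for s t
  proof -
    have "s\<^sup>2 * (v s \<bullet> v t) = t\<^sup>2 * (v s \<bullet> v t)"
      using sym[of "v s" "v t"] v that(1,2) by simp
    \<comment> \<open>Singular values are nonnegative, so distinct ones have distinct
      squares.\<close>
    moreover have "s\<^sup>2 \<noteq> t\<^sup>2"
      using that by (auto simp: singular_value_def)
    ultimately show ?thesis by simp
  qed
  have "pairwise orthogonal (v ` ?S)" "0 \<notin> v ` ?S"
    using orth v by (auto simp: pairwise_def orthogonal_def)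
  then have "finite (v ` ?S)"
    using pairwise_orthogonal_independent independent_imp_finite by blast
  moreover have "inj_on v ?S"
    by (rule inj_onI) (metis orth v inner_eq_zero_iff)
  ultimately show ?thesis by (simp add: finite_image_iff)
qed

text \<open>First-order optimality condition: the quadratic vanishes at \<open>t = 0\<close> and is
  nonnegative, so its slope there is zero.\<close>

lemma nonneg_quadratic_linear_coeff_eq_0:
  fixes b c :: real
  assumes "\<And>t. 0 \<le> 2 * t * b + t\<^sup>2 * c"
  shows "b = 0"
proof (rule ccontr)
  assume "b \<noteq> 0"
  have c: "c \<ge> 0" using assms[of 1] assms[of "-1"] by simp
  \<comment> \<open>Dividing by \<open>c + 1\<close> instead of \<open>c\<close> also covers
    \<open>c = 0\<close>; at \<open>t = - r\<close> the quadratic is strictly negative.\<close>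
  define r where "r = b / (c + 1)"
  have b: "b = r * (c + 1)" using c by (simp add: r_def)
  have "2 * (- r) * b + (- r)\<^sup>2 * c = - (r\<^sup>2 * (c + 2))"
    by (simp add: b algebra_simps power2_eq_square)
  moreover have "0 < r\<^sup>2 * (c + 2)" using c b \<open>b \<noteq> 0\<close> by simp
  ultimately show False using assms[of "- r"] by simp
qed

text \<open>A minimiser of \<open>\<parallel>A v\<parallel>\<close> on the unit sphere of the row space is an eigenvector of
  \<open>A\<^sup>T A\<close>, because the residual \<open>A\<^sup>T A v - \<lambda> v\<close> stays in the row space.\<close>

lemma row_space_singular_value:
  fixes A :: "real^'n^'m"
  assumes "A \<noteq> 0"
  obtains s where "singular_value A s" "0 < s"
    "\<And>v. v \<in> range (\<lambda>y. y v* A) \<Longrightarrow> s * norm v \<le> norm (A *v v)"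
proof -
  let ?S = "range (\<lambda>y. y v* A)"
  note sub = subspace_row_space[of A]
  let ?K = "?S \<inter> sphere 0 1"
  obtain i where i: "row i A \<noteq> 0"
    using assms by (auto simp: row_def vec_eq_iff)
  have "row i A /\<^sub>R norm (row i A) \<in> ?K"
    using i sub row_in_row_space[of i A] by (simp add: subspace_scale)
  moreover have "compact ?K"
    by (intro closed_Int_compact closed_subspace sub) simp
  moreover have "continuous_on ?K (\<lambda>v. norm (A *v v))"
    by (intro continuous_intros linear_continuous_on matrix_vector_mul_bounded_linear)
  ultimately obtain v where vK: "v \<in> ?K" and
      min: "\<And>w. w \<in> ?K \<Longrightarrow> norm (A *v v) \<le> norm (A *v w)"
    using continuous_attains_inf[of ?K "\<lambda>v. norm (A *v v)"] by blast
  define s where "s = norm (A *v v)"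
  have vS: "v \<in> ?S" and v1: "norm v = 1" using vK by auto
  have bound: "s * norm w \<le> norm (A *v w)" if "w \<in> ?S" for w
  proof (cases "w = 0")
    case False
    then have "w /\<^sub>R norm w \<in> ?K" using sub that by (simp add: subspace_scale)
    from min[OF this] show ?thesis
      using False by (simp add: s_def matrix_vector_mult_scaleR field_simps)
  qed simp
  obtain y where y: "v = y v* A" using vS by blast
  \<comment> \<open>The row space meets the kernel only in 0: with \<open>v = y v* A\<close>, the
    product \<open>v \<bullet> v\<close> equals \<open>y \<bullet> (A *v v)\<close>.\<close>
  have "A *v v \<noteq> 0"
  proof
    assume "A *v v = 0"
    then have "v \<bullet> v = 0" using dot_lmul_matrix[of y A v] y by simp
    then show False using v1 by simp
  qed
  then have s: "s > 0" by (simp add: s_def)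
  define u where "u = (A *v v) v* A - s\<^sup>2 *\<^sub>R v"
  have uS: "u \<in> ?S"
    unfolding u_def using sub vS by (intro subspace_diff subspace_scale) auto
  \<comment> \<open>Expand \<open>bound\<close> at the perturbed point
    \<open>v + t *\<^sub>R u\<close>. The constant terms are both \<open>s\<^sup>2\<close> and
    cancel, and the choice of \<open>u\<close> makes the linear coefficient
    \<open>2 * (u \<bullet> u)\<close>.\<close>
  have "0 \<le> 2 * t * (u \<bullet> u) + t\<^sup>2 * ((norm (A *v u))\<^sup>2 - s\<^sup>2 * (norm u)\<^sup>2)" for t
  proof -
    let ?w = "v + t *\<^sub>R u"
    have "?w \<in> ?S" using sub vS uS by (intro subspace_add subspace_scale) auto
    then have "(s * norm ?w)\<^sup>2 \<le> (norm (A *v ?w))\<^sup>2"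
      using bound s by (intro power_mono) auto
    moreover have "(A *v v) \<bullet> (A *v u) = u \<bullet> u + s\<^sup>2 * (v \<bullet> u)"
      by (metis u_def dot_lmul_matrix inner_diff_left inner_scaleR_left diff_add_cancel)
    moreover have "(norm (A *v ?w))\<^sup>2
        = s\<^sup>2 + 2 * t * ((A *v v) \<bullet> (A *v u)) + t\<^sup>2 * (norm (A *v u))\<^sup>2"
      unfolding s_def power2_norm_eq_inner
      by (simp add: matrix_vector_right_distrib matrix_vector_mult_scaleR inner_add_left
          inner_add_right inner_commute power2_eq_square algebra_simps)
    moreover have "(norm ?w)\<^sup>2 = 1 + 2 * t * (v \<bullet> u) + t\<^sup>2 * (norm u)\<^sup>2"
      using v1 unfolding power2_norm_eq_inner norm_eq_1
      by (simp add: inner_add_left inner_add_right inner_commute power2_eq_square algebra_simps)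
    ultimately show ?thesis by (simp add: power_mult_distrib algebra_simps)
  qed
  then have "u \<bullet> u = 0" by (rule nonneg_quadratic_linear_coeff_eq_0)
  then have "(transpose A ** A) *v v = s\<^sup>2 *\<^sub>R v"
    by (simp add: u_def flip: matrix_vector_mul_assoc)
  then have "singular_value A s"
    unfolding singular_value_def using s v1 by (intro conjI exI[of _ v]) auto
  then show ?thesis using that s bound by blast
qed

text \<open>The minimum on the unit sphere of the row space is itself a nonzero singular value, so
  \<open>sigma_min A\<close> is at most that value and inherits its lower bound.\<close>

lemma
  fixes A :: "real^'n^'m"
  assumes "A \<noteq> 0"
  shows sigma_min_pos: "0 < sigma_min A"
    and sigma_min_bound:
      "v \<in> range (\<lambda>y. y v* A) \<Longrightarrow> sigma_min A * norm v \<le> norm (A *v v)"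
proof -
  obtain s where s: "singular_value A s" "0 < s"
    and b: "\<And>v. v \<in> range (\<lambda>y. y v* A) \<Longrightarrow> s * norm v \<le> norm (A *v v)"
    using row_space_singular_value[OF assms] by metis
  let ?T = "{s. singular_value A s \<and> s \<noteq> 0}"
  have fin: "finite ?T"
    by (rule finite_subset[OF _ finite_singular_values[of A]]) auto
  have "sigma_min A \<in> ?T"
    unfolding sigma_min_def using fin s by (intro Min_in) auto
  then show "0 < sigma_min A" by (auto simp: singular_value_def)
  have le: "sigma_min A \<le> s"
    unfolding sigma_min_def using fin s by (intro Min_le) auto
  show "sigma_min A * norm v \<le> norm (A *v v)" if "v \<in> range (\<lambda>y. y v* A)"
    by (rule order_trans[OF mult_right_mono[OF le] b[OF that]]) simp
qed

lemma norm_matrix_power2_rows: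
  fixes A :: "real^'n^'m"
  shows "(norm A)\<^sup>2 = (\<Sum>i\<in>UNIV. (norm (row i A))\<^sup>2)"
  unfolding power2_norm_eq_inner by (subst inner_vec_def) (simp add: row_def)

lemma norm_matrix_power2_columns:
  fixes X :: "real^'p^'n"
  shows "(norm X)\<^sup>2 = (\<Sum>l\<in>UNIV. (norm (column l X))\<^sup>2)"
  unfolding power2_norm_eq_inner inner_vec_def column_def
  by (simp add: sum.swap[of _ "UNIV :: 'n set"])

lemma norm_matrix_vector_power2:
  fixes A :: "real^'n^'m"
  shows "(norm (A *v x))\<^sup>2 = (\<Sum>i\<in>UNIV. (row i A \<bullet> x)\<^sup>2)"
  unfolding power2_norm_eq_inner
  by (subst inner_vec_def) (simp add: matrix_vector_mul_component row_def power2_eq_square)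

text \<open>Makes the contraction factor nonnegative. Any nonzero row lies in the row space, and
  Cauchy-Schwarz row by row bounds the image of a vector by the Frobenius norm of
  \<open>A\<close>.\<close>

lemma sigma_min_le_norm:
  fixes A :: "real^'n^'m"
  assumes "A \<noteq> 0"
  shows "sigma_min A \<le> norm A"
proof -
  obtain i where i: "row i A \<noteq> 0"
    using assms by (auto simp: row_def vec_eq_iff)
  let ?v = "row i A"
  have "(norm (A *v ?v))\<^sup>2 \<le> (\<Sum>j\<in>UNIV. (norm (row j A))\<^sup>2 * (norm ?v)\<^sup>2)"
    unfolding norm_matrix_vector_power2
    by (intro sum_mono) (metis Cauchy_Schwarz_ineq power2_norm_eq_inner)
  also have "\<dots> = (norm A * norm ?v)\<^sup>2"
    by (simp add: norm_matrix_power2_rows power_mult_distrib sum_distrib_right)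
  finally have "norm (A *v ?v) \<le> norm A * norm ?v"
    by (rule power2_le_imp_le) simp
  then have "sigma_min A * norm ?v \<le> norm A * norm ?v"
    using sigma_min_bound[OF assms row_in_row_space[of i A]] by simp
  then show ?thesis using i by simp
qed

section \<open>One step of the iteration\<close>

text \<open>The factor \<open>c\<close> is \<open>0\<close> by convention when \<open>a = 0\<close>.\<close>

lemma norm_projection_power2:
  fixes a v :: "'a::real_inner"
  defines "c \<equiv> (a \<bullet> v) / (norm a)\<^sup>2"
  shows "(norm (v - c *\<^sub>R a))\<^sup>2 = (norm v)\<^sup>2 - (a \<bullet> v)\<^sup>2 / (norm a)\<^sup>2"
proof (cases "a = 0")
  case False
  then have "c * (a \<bullet> a) = a \<bullet> v" by (simp add: c_def power2_norm_eq_inner)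
  moreover have "(norm (v - c *\<^sub>R a))\<^sup>2 = (norm v)\<^sup>2 - 2 * c * (a \<bullet> v) + c * (c * (a \<bullet> a))"
    unfolding power2_norm_eq_inner
    by (simp add: inner_diff_left inner_diff_right inner_commute algebra_simps)
  ultimately show ?thesis
    by (simp add: c_def power2_eq_square)
qed (simp add: c_def)

lemma column_kaczmarz_step_error:
  fixes A :: "real^'n^'m" and X Y :: "real^'p^'n"
  assumes "A ** Y = B"
  shows "column l (kaczmarz_step A B i X - Y) =
    column l (X - Y) - ((row i A \<bullet> column l (X - Y)) / (norm (row i A))\<^sup>2) *\<^sub>R row i A"
proof -
  have "(row i B - row i A v* X) $ l = - (row i A \<bullet> column l (X - Y))"
    unfolding assms[symmetric]
    by (simp add: row_def column_def matrix_matrix_mult_def vector_matrix_mult_def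
        inner_vec_def sum_subtractf algebra_simps)
  then show ?thesis
    unfolding kaczmarz_step_def by (simp add: vec_eq_iff column_def)
qed

lemma norm_kaczmarz_step_error:
  fixes A :: "real^'n^'m" and X Y :: "real^'p^'n"
  assumes "A ** Y = B"
  shows "(norm (kaczmarz_step A B i X - Y))\<^sup>2 = (norm (X - Y))\<^sup>2 -
    (\<Sum>l\<in>UNIV. (row i A \<bullet> column l (X - Y))\<^sup>2 / (norm (row i A))\<^sup>2)"
  unfolding norm_matrix_power2_columns column_kaczmarz_step_error[OF assms]
    norm_projection_power2 by (simp add: sum_subtractf)

text \<open>Holds for every index sequence, so it supplies the constant bounds behind
  integrability.\<close>

lemma kaczmarz_error_antimono:
  fixes A :: "real^'n^'m" and X0 Y :: "real^'p^'n"
  assumes "A ** Y = B"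
  shows "(norm (kaczmarz A B X0 idx k - Y))\<^sup>2 \<le> (norm (X0 - Y))\<^sup>2"
proof (induction k)
  case (Suc k)
  have "(norm (kaczmarz A B X0 idx (Suc k) - Y))\<^sup>2 \<le> (norm (kaczmarz A B X0 idx k - Y))\<^sup>2"
    by (simp add: norm_kaczmarz_step_error[OF assms] sum_nonneg)
  then show ?case using Suc by linarith
qed simp

lemma kaczmarz_error_in_row_space:
  fixes A :: "real^'n^'m" and X0 Y :: "real^'p^'n"
  assumes "A ** Y = B" and "\<And>l. column l (X0 - Y) \<in> range (\<lambda>y. y v* A)"
  shows "column l (kaczmarz A B X0 idx k - Y) \<in> range (\<lambda>y. y v* A)"
proof (induction k)
  case 0
  then show ?case using assms(2) by simp
next
  case (Suc k)
  show ?case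
    unfolding kaczmarz.simps column_kaczmarz_step_error[OF assms(1)]
    by (intro subspace_diff subspace_scale subspace_row_space row_in_row_space Suc)
qed

lemma mean_kaczmarz_step_error:
  fixes A :: "real^'n^'m" and X Y :: "real^'p^'n"
  assumes "A \<noteq> 0" and "A ** Y = B"
    and row_space: "\<And>l. column l (X - Y) \<in> range (\<lambda>y. y v* A)"
  shows "(\<Sum>i\<in>UNIV. (norm (row i A))\<^sup>2 / (norm A)\<^sup>2 * (norm (kaczmarz_step A B i X - Y))\<^sup>2)
    \<le> (1 - (sigma_min A)\<^sup>2 / (norm A)\<^sup>2) * (norm (X - Y))\<^sup>2"
proof -
  let ?e = "\<lambda>l. column l (X - Y)"
  \<comment> \<open>The selection weight cancels the denominator of the decrease. For a zero row
    both sides vanish.\<close>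
  have weighted: "(norm (row i A))\<^sup>2 * (norm (kaczmarz_step A B i X - Y))\<^sup>2
      = (norm (row i A))\<^sup>2 * (norm (X - Y))\<^sup>2 - (\<Sum>l\<in>UNIV. (row i A \<bullet> ?e l)\<^sup>2)" for i
    unfolding norm_kaczmarz_step_error[OF assms(2)]
    by (cases "row i A = 0") (simp_all add: right_diff_distrib sum_distrib_left)
  have "(\<Sum>i\<in>UNIV. (norm (row i A))\<^sup>2 * (norm (kaczmarz_step A B i X - Y))\<^sup>2)
      = (norm A)\<^sup>2 * (norm (X - Y))\<^sup>2 - (\<Sum>l\<in>UNIV. (norm (A *v ?e l))\<^sup>2)"
    unfolding weighted norm_matrix_vector_power2 norm_matrix_power2_rows[of A]
    by (simp add: sum_subtractf sum_distrib_right sum.swap[of _ "UNIV :: 'm set"])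
  moreover have "(sigma_min A)\<^sup>2 * (norm (X - Y))\<^sup>2 \<le> (\<Sum>l\<in>UNIV. (norm (A *v ?e l))\<^sup>2)"
    unfolding norm_matrix_power2_columns[of "X - Y"] sum_distrib_left
  proof (intro sum_mono)
    fix l
    have "(sigma_min A * norm (?e l))\<^sup>2 \<le> (norm (A *v ?e l))\<^sup>2"
      using sigma_min_bound[OF assms(1) row_space[of l]] sigma_min_pos[OF assms(1)]
      by (intro power_mono) auto
    then show "(sigma_min A)\<^sup>2 * (norm (?e l))\<^sup>2 \<le> (norm (A *v ?e l))\<^sup>2"
      by (simp add: power_mult_distrib)
  qed
  ultimately have "(\<Sum>i\<in>UNIV. (norm (row i A))\<^sup>2 * (norm (kaczmarz_step A B i X - Y))\<^sup>2) / (norm A)\<^sup>2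
      \<le> ((norm A)\<^sup>2 * (norm (X - Y))\<^sup>2 - (sigma_min A)\<^sup>2 * (norm (X - Y))\<^sup>2) / (norm A)\<^sup>2"
    by (intro divide_right_mono) auto
  also have "\<dots> = (1 - (sigma_min A)\<^sup>2 / (norm A)\<^sup>2) * (norm (X - Y))\<^sup>2"
    using assms(1) by (simp add: field_simps)
  finally show ?thesis by (simp add: sum_divide_distrib)
qed

section \<open>Expected error\<close>

lemma kaczmarz_restrict:
  "kaczmarz A B X0 (restrict idx {..<k}) k = kaczmarz A B X0 idx k"
proof -
  \<comment> \<open>Induct on \<open>j\<close> with \<open>k\<close> fixed, so that the restriction
    set does not change; iterate \<open>j\<close> reads only indices below \<open>j\<close>.\<close>
  have "j \<le> k \<Longrightarrow> kaczmarz A B X0 (restrict idx {..<k}) j = kaczmarz A B X0 idx j" for j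
    by (induction j) auto
  then show ?thesis by simp
qed

text \<open>The two variables depend on the disjoint index blocks \<open>{k}\<close> and
  \<open>{..<k}\<close>.\<close>

lemma (in prob_space) indep_var_kaczmarz:
  fixes A :: "real^'n^'m" and idx :: "nat \<Rightarrow> 'a \<Rightarrow> 'm" and F :: "real^'p^'n \<Rightarrow> real"
    and g :: "'m \<Rightarrow> real"
  assumes "indep_vars (\<lambda>_. count_space UNIV) idx UNIV"
  shows "indep_var borel (\<lambda>\<omega>. g (idx k \<omega>)) borel (\<lambda>\<omega>. F (kaczmarz A B X0 (\<lambda>t. idx t \<omega>) k))"
proof -
  \<comment> \<open>A finite product of finite discrete spaces is discrete, so arbitrary
    \<open>F\<close> and \<open>g\<close> are allowed.\<close>
  have discrete: "f \<in> borel_measurable (PiM I (\<lambda>_. count_space (UNIV :: 'm set)))"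
    if "finite I" for I :: "nat set" and f :: "(nat \<Rightarrow> 'm) \<Rightarrow> real"
    using count_space_PiM_finite[of I "\<lambda>_. UNIV :: 'm set"] that
    by (simp add: countable_finite)
  have "indep_var (PiM {k} (\<lambda>_. count_space UNIV)) (\<lambda>\<omega>. restrict (\<lambda>i. idx i \<omega>) {k})
      (PiM {..<k} (\<lambda>_. count_space UNIV)) (\<lambda>\<omega>. restrict (\<lambda>i. idx i \<omega>) {..<k})"
    by (rule indep_var_restrict[OF assms]) auto
  from indep_var_compose[OF this discrete[of "{k}" "\<lambda>h. g (h k)"]
      discrete[of "{..<k}" "\<lambda>h. F (kaczmarz A B X0 h k)"]]
  show ?thesis by (simp add: o_def kaczmarz_restrict)
qed

lemma (in prob_space) borel_measurable_kaczmarz: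
  fixes A :: "real^'n^'m" and idx :: "nat \<Rightarrow> 'a \<Rightarrow> 'm" and F :: "real^'p^'n \<Rightarrow> real"
  assumes "indep_vars (\<lambda>_. count_space UNIV) idx UNIV"
  shows "(\<lambda>\<omega>. F (kaczmarz A B X0 (\<lambda>t. idx t \<omega>) k)) \<in> borel_measurable M"
  using indep_var_rv2[OF indep_var_kaczmarz[OF assms, where g = "\<lambda>_. 0"]] .

lemma (in prob_space) expected_kaczmarz_error:
  fixes A :: "real^'n^'m" and X0 Y :: "real^'p^'n" and idx :: "nat \<Rightarrow> 'a \<Rightarrow> 'm"
  assumes "A \<noteq> 0" and AY: "A ** Y = B" and sel: "row_selection M A idx"
    and row_space: "\<And>l. column l (X0 - Y) \<in> range (\<lambda>y. y v* A)"
  defines "X \<equiv> \<lambda>k \<omega>. kaczmarz A B X0 (\<lambda>t. idx t \<omega>) k"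
  shows integrable_kaczmarz_error: "integrable M (\<lambda>\<omega>. (norm (X k \<omega> - Y))\<^sup>2)"
    and "expectation (\<lambda>\<omega>. (norm (X k \<omega> - Y))\<^sup>2)
      \<le> (1 - (sigma_min A)\<^sup>2 / (norm A)\<^sup>2) ^ k * (norm (X0 - Y))\<^sup>2"
proof -
  have indep: "indep_vars (\<lambda>_. count_space UNIV) idx UNIV"
    and pr: "prob {\<omega> \<in> space M. idx k \<omega> = i} = (norm (row i A))\<^sup>2 / (norm A)\<^sup>2" for k i
    using sel by (auto simp: row_selection_def frob_norm_eq_norm)
  have idx[measurable]: "idx k \<in> measurable M (count_space UNIV)" for k
    using indep by (auto simp: indep_vars_def)
  let ?q = "1 - (sigma_min A)\<^sup>2 / (norm A)\<^sup>2"
  have q: "0 \<le> ?q"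
    using assms(1) sigma_min_le_norm[OF assms(1)] sigma_min_pos[OF assms(1)]
    by (simp add: power_mono)
  have int: "integrable M (\<lambda>\<omega>. (norm (X k \<omega> - Y))\<^sup>2)" for k
    unfolding X_def
    by (rule integrable_const_bound[where B = "(norm (X0 - Y))\<^sup>2"])
      (auto simp: kaczmarz_error_antimono[OF AY] intro!: borel_measurable_kaczmarz[OF indep,
        where F = "\<lambda>Z. (norm (Z - Y))\<^sup>2"])
  then show "integrable M (\<lambda>\<omega>. (norm (X k \<omega> - Y))\<^sup>2)" .
  let ?G = "\<lambda>i Z. (norm (kaczmarz_step A B i Z - Y))\<^sup>2"
  have intG: "integrable M (\<lambda>\<omega>. ?G i (X k \<omega>))" for i k
    unfolding X_def
  proof (rule integrable_const_bound[where B = "(norm (X0 - Y))\<^sup>2"])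
    show "(\<lambda>\<omega>. ?G i (kaczmarz A B X0 (\<lambda>t. idx t \<omega>) k)) \<in> borel_measurable M"
      by (rule borel_measurable_kaczmarz[OF indep])
    have "?G i (kaczmarz A B X0 (\<lambda>t. idx t \<omega>) k) \<le> (norm (X0 - Y))\<^sup>2" for \<omega>
      using kaczmarz_error_antimono[OF AY, of X0 "\<lambda>t. idx t \<omega>" k]
      by (rule order_trans[rotated]) (simp add: norm_kaczmarz_step_error[OF AY] sum_nonneg)
    then show "AE \<omega> in M. norm (?G i (kaczmarz A B X0 (\<lambda>t. idx t \<omega>) k)) \<le> (norm (X0 - Y))\<^sup>2"
      by simp
  qed
  let ?I = "\<lambda>k i \<omega>. indicator {i} (idx k \<omega>) :: real"
  have intI: "integrable M (?I k i)" for k i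
    by (rule integrable_const_bound[where B = 1]) (auto simp: indicator_def)
  have EI: "expectation (?I k i) = (norm (row i A))\<^sup>2 / (norm A)\<^sup>2" for k i
  proof -
    have "expectation (?I k i) = expectation (indicator {\<omega> \<in> space M. idx k \<omega> = i})"
      by (intro Bochner_Integration.integral_cong) (auto simp: indicator_def)
    then show ?thesis using pr by simp
  qed
  have ind: "indep_var borel (?I k i) borel (\<lambda>\<omega>. ?G i (X k \<omega>))" for k i
    unfolding X_def by (rule indep_var_kaczmarz[OF indep])
  show "expectation (\<lambda>\<omega>. (norm (X k \<omega> - Y))\<^sup>2) \<le> ?q ^ k * (norm (X0 - Y))\<^sup>2"
  proof (induction k)
    case 0
    show ?case by (simp add: X_def prob_space)
  next
    case (Suc k)
    \<comment> \<open>Split by the selected row: only the summand with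
      \<open>i = idx k \<omega>\<close> survives, and each summand is a product of independent
      factors.\<close>
    have "(norm (X (Suc k) \<omega> - Y))\<^sup>2 = (\<Sum>i\<in>UNIV. ?I k i \<omega> * ?G i (X k \<omega>))" for \<omega>
      by (simp add: X_def indicator_def of_bool_def if_distrib if_distribR cong: if_cong)
    then have "expectation (\<lambda>\<omega>. (norm (X (Suc k) \<omega> - Y))\<^sup>2)
        = expectation (\<lambda>\<omega>. \<Sum>i\<in>UNIV. ?I k i \<omega> * ?G i (X k \<omega>))" by simp
    also have "\<dots> = (\<Sum>i\<in>UNIV. expectation (\<lambda>\<omega>. ?I k i \<omega> * ?G i (X k \<omega>)))"
      by (intro Bochner_Integration.integral_sum indep_var_integrable[OF ind intI intG])
    \<comment> \<open>The sum returns inside the expectation so that the one-step mean estimate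
      applies at each \<open>\<omega>\<close>.\<close>
    also have "\<dots> = (\<Sum>i\<in>UNIV. (norm (row i A))\<^sup>2 / (norm A)\<^sup>2 * expectation (\<lambda>\<omega>. ?G i (X k \<omega>)))"
      by (simp only: indep_var_lebesgue_integral[OF ind intI intG] EI)
    also have "\<dots> = expectation (\<lambda>\<omega>. \<Sum>i\<in>UNIV. (norm (row i A))\<^sup>2 / (norm A)\<^sup>2 * ?G i (X k \<omega>))"
      by (subst Bochner_Integration.integral_sum)
        (simp_all only: integral_mult_right_zero integrable_mult_right intG)
    also have "\<dots> \<le> expectation (\<lambda>\<omega>. ?q * (norm (X k \<omega> - Y))\<^sup>2)"
    proof (rule integral_mono)
      show "(\<Sum>i\<in>UNIV. (norm (row i A))\<^sup>2 / (norm A)\<^sup>2 * ?G i (X k \<omega>))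
          \<le> ?q * (norm (X k \<omega> - Y))\<^sup>2" for \<omega>
        unfolding X_def
        by (rule mean_kaczmarz_step_error[OF assms(1) AY
              kaczmarz_error_in_row_space[OF AY row_space]])
    qed (intro Bochner_Integration.integrable_sum integrable_mult_right intG int)+
    also have "\<dots> = ?q * expectation (\<lambda>\<omega>. (norm (X k \<omega> - Y))\<^sup>2)" by simp
    also have "\<dots> \<le> ?q * (?q ^ k * (norm (X0 - Y))\<^sup>2)"
      using Suc q by (rule mult_left_mono)
    finally show ?case by (simp add: mult.assoc)
  qed
qed

theorem theorem2p2:
  fixes A :: "real^'n^'m" and B :: "real^'p^'m" and X0 :: "real^'p^'n"
    and M :: "'w measure" and idx :: "nat \<Rightarrow> 'w \<Rightarrow> 'm"
    and X :: "nat \<Rightarrow> 'w \<Rightarrow> real^'p^'n" and Xstar :: "real^'p^'n"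
  assumes "A \<noteq> 0"
    and "\<exists>Z :: real^'p^'n. A ** Z = B"
    and "prob_space M"
    and "row_selection M A idx"
  defines "X \<equiv> \<lambda>k \<omega>. kaczmarz A B X0 (\<lambda>t. idx t \<omega>) k"
    and "Xstar \<equiv> pinv A ** B + (mat 1 - pinv A ** A) ** X0"
  shows "converges_linearly_in_mean_square M X Xstar \<and>
    (\<forall>k. (\<integral>\<omega>. (frob_norm (X k \<omega> - Xstar))\<^sup>2 \<partial>M)
       \<le> (1 - (sigma_min A)\<^sup>2 / (frob_norm A)\<^sup>2) ^ k * (frob_norm (X0 - Xstar))\<^sup>2)"
proof -
  interpret prob_space M by fact
  obtain Z where Z: "A ** Z = B" using assms(2) by blast
  have P: "A ** pinv A ** A = A" "transpose (pinv A ** A) = pinv A ** A"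
    using penrose_pinv[of A] by (auto simp: penrose_conditions_def)
  have "A ** (pinv A ** B) = B"
    using P(1) Z by (metis matrix_mul_assoc)
  moreover have "A ** ((mat 1 - pinv A ** A) ** X0) = 0"
    using P(1) by (simp add: matrix_mul_assoc matrix_mult_diff_ldistrib)
  ultimately have AY: "A ** Xstar = B"
    by (simp add: Xstar_def matrix_add_ldistrib)
  have "X0 - Xstar = pinv A ** A ** (X0 - Z)"
    by (simp add: Xstar_def matrix_mult_diff_ldistrib matrix_mult_diff_rdistrib
        flip: Z matrix_mul_assoc)
  \<comment> \<open>Symmetry of \<open>pinv A ** A\<close> exposes a left factor
    \<open>transpose A\<close>, which places every column of the initial error in the row
    space.\<close>
  also have "\<dots> = transpose A ** (transpose (pinv A) ** (X0 - Z))"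
    using P(2) by (metis matrix_mul_assoc matrix_transpose_mul)
  finally have "column l (X0 - Xstar) \<in> range (\<lambda>y. y v* A)" for l
    by (simp add: column_matrix_mult)
  note err = expected_kaczmarz_error[OF assms(1) AY assms(4) this]
  let ?q = "1 - (sigma_min A)\<^sup>2 / (norm A)\<^sup>2"
  have "0 \<le> ?q" "?q < 1"
    using assms(1) sigma_min_le_norm[OF assms(1)] sigma_min_pos[OF assms(1)]
    by (simp_all add: power_mono)
  moreover have "expectation (\<lambda>\<omega>. (norm (X k \<omega> - Xstar))\<^sup>2) \<le> (norm (X0 - Xstar))\<^sup>2 * ?q ^ k" for k
    using err(2) by (simp add: X_def mult.commute)
  ultimately have "\<exists>c q. 0 \<le> c \<and> 0 \<le> q \<and> q < 1 \<and>
      (\<forall>k. expectation (\<lambda>\<omega>. (norm (X k \<omega> - Xstar))\<^sup>2) \<le> c * q ^ k)"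
    by (meson zero_le_power2)
  then show ?thesis
    using err unfolding converges_linearly_in_mean_square_def frob_norm_eq_norm X_def by blast
qed

end
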